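(* Let $G$ be a Lie group with Lie algebra $\mathfrak g$ and let $l:\mathfrak g\times\mathbb R\to\mathbb R$ be a smooth (reduced Lagrangian) function which is regular and whose reduced Legendre transformation $$\mathbb F l:\mathfrak g\times\mathbb R\to\mathfrak g^*\times\mathbb R,\qquad \mathbb Fl(\xi,z)=\left(\frac{\delta l}{\delta\xi}(\xi,z),z\right),$$ is a diffeomorphism. Define $h:\mathfrak g^*\times\mathbb R\to\mathbb R$ by $h(\mu,z)=\langle\mu,\xi\rangle-l(\xi,z)$, where $\xi$ is determined by $\mu=\frac{\delta l}{\delta\xi}(\xi,z)$. If $(\xi(t),z(t))$ is a solution of the Euler-Poincaré-Herglotz equations $$\frac{d}{dt}\frac{\delta l}{\delta\xi}=\operatorname{ad}^*_\xi\frac{\delta l}{\delta\xi}+\frac{\delta l}{\delta\xi}\frac{\partial l}{\partial z},\qquad\dot z=l(\xi,z),$$ and $\mu(t)=\frac{\delta l}{\delta\xi}(\xi(t),z(t))$, then the curve $t\mapsto(\mu(t),z(t))$ satisfies the equations $$\dot\mu=\operatorname{ad}^*_{\frac{\delta h}{\delta\mu}}\mu-\mu\frac{\partial h}{\partial z},\qquad \dot z=\left\langle\mu,\frac{\delta h}{\delta\mu}\right\rangle-h(\mu,z).$$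
   Context: $\frac{\delta l}{\delta\xi}\in\mathfrak g^*$ and $\frac{\delta h}{\delta\mu}\in\mathfrak g^{**}\cong\mathfrak g$ denote partial derivatives with respect to the vector-space variables $\xi\in\mathfrak g$ and $\mu\in\mathfrak g^*$. $\operatorname{ad}^*_\xi:\mathfrak g^*\to\mathfrak g^*$ is the dual of $\operatorname{ad}_\xi=[\xi,\cdot]$: $\langle\operatorname{ad}^*_\xi\mu,\eta\rangle=\langle\mu,[\xi,\eta]\rangle$. $l$ regular means that the Hessian of $l$ in the variable $\xi$ is everywhere invertible. *)

theory Defs
  imports "HOL-Analysis.Analysis" "HOL-Algebra.Group"
begin

section \<open>Smooth maps\<close>

text \<open>For maps on an open subset of a finite-dimensional normed space,
  \<open>Ck_on k S f\<close> says that all iterated directional derivatives up to order \<open>k\<close> exist,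
  the derivatives up to order \<open>k - 1\<close> being (Frechet) differentiable, and are continuous.\<close>

primrec Ck_on :: "nat \<Rightarrow> 'v::real_normed_vector set \<Rightarrow> ('v \<Rightarrow> 'w::real_normed_vector) \<Rightarrow> bool" where
  "Ck_on 0 S f \<longleftrightarrow> continuous_on S f"
| "Ck_on (Suc k) S f \<longleftrightarrow> (\<forall>x\<in>S. f differentiable (at x)) \<and>
     (\<forall>v. Ck_on k S (\<lambda>x. frechet_derivative f (at x) v))"

definition smooth_on :: "'v::real_normed_vector set \<Rightarrow> ('v \<Rightarrow> 'w::real_normed_vector) \<Rightarrow> bool" where
  "smooth_on S f \<longleftrightarrow> (\<forall>k. Ck_on k S f)"

definition diffeomorphism :: "('v::real_normed_vector \<Rightarrow> 'w::real_normed_vector) \<Rightarrow> bool" where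
  "diffeomorphism f \<longleftrightarrow> bij f \<and> smooth_on UNIV f \<and> smooth_on UNIV (inv_into UNIV f)"


section \<open>Lie groups and their Lie algebras\<close>

text \<open>A chart is a pair of its domain and its coordinate map. The model space \<open>'e\<close> is any
  finite-dimensional normed space rather than a \<open>euclidean_space\<close>, since the latter class
  excludes dimension zero.\<close>

type_synonym ('a, 'e) chart = "'a set \<times> ('a \<Rightarrow> 'e)"

definition smooth_manifold :: "'a topology \<Rightarrow> ('a, 'e::real_normed_vector) chart set \<Rightarrow> bool" where
  "smooth_manifold X A \<longleftrightarrow>
     (\<exists>B::'e set. finite B \<and> span B = UNIV) \<and>
     Hausdorff_space X \<and> second_countable X \<and>
     (\<Union>(U, \<phi>)\<in>A. U) = topspace X \<and>
     (\<forall>(U, \<phi>)\<in>A. openin X U \<and> open (\<phi> ` U) \<and>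
        homeomorphic_map (subtopology X U) (top_of_set (\<phi> ` U)) \<phi>) \<and>
     (\<forall>(U, \<phi>)\<in>A. \<forall>(V, \<psi>)\<in>A. smooth_on (\<phi> ` (U \<inter> V)) (\<psi> \<circ> inv_into U \<phi>))"

definition lie_group ::
  "('a, 'b) monoid_scheme \<Rightarrow> 'a topology \<Rightarrow> ('a, 'e::real_normed_vector) chart set \<Rightarrow> bool" where
  "lie_group G X A \<longleftrightarrow>
     group G \<and> carrier G = topspace X \<and> smooth_manifold X A \<and>
     continuous_map (prod_topology X X) X (\<lambda>(x, y). x \<otimes>\<^bsub>G\<^esub> y) \<and>
     continuous_map X X (m_inv G) \<and>
     (\<forall>(U, \<phi>)\<in>A. \<forall>(V, \<psi>)\<in>A. \<forall>(W, \<theta>)\<in>A.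
        smooth_on {(u, v). u \<in> \<phi> ` U \<and> v \<in> \<psi> ` V \<and> inv_into U \<phi> u \<otimes>\<^bsub>G\<^esub> inv_into V \<psi> v \<in> W}
          (\<lambda>(u, v). \<theta> (inv_into U \<phi> u \<otimes>\<^bsub>G\<^esub> inv_into V \<psi> v))) \<and>
     (\<forall>(U, \<phi>)\<in>A. \<forall>(V, \<psi>)\<in>A.
        smooth_on {u \<in> \<phi> ` U. m_inv G (inv_into U \<phi> u) \<in> V} (\<lambda>u. \<psi> (m_inv G (inv_into U \<phi> u))))"

text \<open>The left-invariant vector field whose value at the identity has coordinates \<open>e\<close>, written in
  the coordinates \<open>u\<close> of a chart around the identity: the derivative of left translation by the
  point with coordinates \<open>u\<close>, taken at the identity.\<close>

definition left_invariant_field ::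
  "('a, 'b) monoid_scheme \<Rightarrow> ('a, 'e::real_normed_vector) chart \<Rightarrow> 'e \<Rightarrow> 'e \<Rightarrow> 'e" where
  "left_invariant_field G = (\<lambda>(U, \<phi>) e u.
     frechet_derivative (\<lambda>v. \<phi> (inv_into U \<phi> u \<otimes>\<^bsub>G\<^esub> inv_into U \<phi> v)) (at (\<phi> \<one>\<^bsub>G\<^esub>)) e)"

text \<open>\<open>[X, Y] = DY X - DX Y\<close>, the bracket of vector fields acting as derivations.\<close>

definition vector_field_bracket ::
  "('e::real_normed_vector \<Rightarrow> 'e) \<Rightarrow> ('e \<Rightarrow> 'e) \<Rightarrow> 'e \<Rightarrow> 'e" where
  "vector_field_bracket X Y u =
     frechet_derivative Y (at u) (X u) - frechet_derivative X (at u) (Y u)"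

text \<open>\<open>br\<close> makes the vector space \<open>'g\<close> the Lie algebra of \<open>G\<close>: some linear isomorphism \<open>T\<close> from
  \<open>'g\<close> to the tangent space at the identity, seen in a chart, carries \<open>br\<close> to the bracket of
  left-invariant vector fields, evaluated at the identity.\<close>

definition lie_algebra_of ::
  "('a, 'b) monoid_scheme \<Rightarrow> ('a, 'e::real_normed_vector) chart set \<Rightarrow>
   ('g::real_normed_vector \<Rightarrow> 'g \<Rightarrow> 'g) \<Rightarrow> bool" where
  "lie_algebra_of G A br \<longleftrightarrow>
     (\<exists>(U, \<phi>)\<in>A. \<one>\<^bsub>G\<^esub> \<in> U \<and>
        (\<exists>T::'g \<Rightarrow> 'e. linear T \<and> bij T \<and>
           (\<forall>\<xi> \<eta>. T (br \<xi> \<eta>) =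
              vector_field_bracket (left_invariant_field G (U, \<phi>) (T \<xi>))
                (left_invariant_field G (U, \<phi>) (T \<eta>)) (\<phi> \<one>\<^bsub>G\<^esub>))))"

text \<open>The dual \<open>\<gg>\<^sup>*\<close> is \<open>'g \<Rightarrow>\<^sub>L real\<close>; in finite dimension every linear functional is bounded.
  The coadjoint operator is the plain transpose, \<open>\<langle>ad\<^sup>*\<^sub>\<xi> \<mu>, \<eta>\<rangle> = \<langle>\<mu>, [\<xi>, \<eta>]\<rangle>\<close>, without a sign.\<close>

definition ad_dual ::
  "('g::real_normed_vector \<Rightarrow> 'g \<Rightarrow> 'g) \<Rightarrow> 'g \<Rightarrow> ('g \<Rightarrow>\<^sub>L real) \<Rightarrow> ('g \<Rightarrow>\<^sub>L real)" where
  "ad_dual br \<xi> \<mu> = Blinfun (\<lambda>\<eta>. blinfun_apply \<mu> (br \<xi> \<eta>))"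


section \<open>Partial derivatives\<close>

definition partial_vec :: "('v::real_normed_vector \<times> real \<Rightarrow> real) \<Rightarrow> 'v \<Rightarrow> real \<Rightarrow> 'v \<Rightarrow>\<^sub>L real" where
  "partial_vec f x z = Blinfun (frechet_derivative (\<lambda>y. f (y, z)) (at x))"

definition partial_real :: "('v \<times> real \<Rightarrow> real) \<Rightarrow> 'v \<Rightarrow> real \<Rightarrow> real" where
  "partial_real f x z = deriv (\<lambda>s. f (x, s)) z"

text \<open>The canonical map from \<open>\<gg>\<close> to \<open>\<gg>\<^sup>*\<^sup>*\<close>, used to read the derivative of a function on
  \<open>\<gg>\<^sup>*\<close> as an element of \<open>\<gg>\<close>.\<close>

definition bidual_map :: "'g::real_normed_vector \<Rightarrow> ('g \<Rightarrow>\<^sub>L real) \<Rightarrow>\<^sub>L real" where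
  "bidual_map \<xi> = Blinfun (\<lambda>\<mu>. blinfun_apply \<mu> \<xi>)"

definition partial_dual ::
  "(('g::real_normed_vector \<Rightarrow>\<^sub>L real) \<times> real \<Rightarrow> real) \<Rightarrow> ('g \<Rightarrow>\<^sub>L real) \<Rightarrow> real \<Rightarrow> 'g" where
  "partial_dual h \<mu> z = inv_into UNIV bidual_map (partial_vec h \<mu> z)"


section \<open>Reduced Lagrangians and Hamiltonians\<close>

definition regular_lagrangian :: "('g::real_normed_vector \<times> real \<Rightarrow> real) \<Rightarrow> bool" where
  "regular_lagrangian l \<longleftrightarrow>
     (\<forall>\<xi> z. bij (frechet_derivative (\<lambda>\<eta>. partial_vec l \<eta> z) (at \<xi>)))"

definition legendre ::
  "('g::real_normed_vector \<times> real \<Rightarrow> real) \<Rightarrow> 'g \<times> real \<Rightarrow> ('g \<Rightarrow>\<^sub>L real) \<times> real" where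
  "legendre l = (\<lambda>(\<xi>, z). (partial_vec l \<xi> z, z))"

definition legendre_hamiltonian ::
  "('g::real_normed_vector \<times> real \<Rightarrow> real) \<Rightarrow> ('g \<Rightarrow>\<^sub>L real) \<times> real \<Rightarrow> real" where
  "legendre_hamiltonian l = (\<lambda>(\<mu>, z).
     let \<xi> = (THE \<xi>. \<mu> = partial_vec l \<xi> z) in blinfun_apply \<mu> \<xi> - l (\<xi>, z))"

definition euler_poincare_herglotz ::
  "('g::real_normed_vector \<Rightarrow> 'g \<Rightarrow> 'g) \<Rightarrow> ('g \<times> real \<Rightarrow> real) \<Rightarrow>
   real set \<Rightarrow> (real \<Rightarrow> 'g) \<Rightarrow> (real \<Rightarrow> real) \<Rightarrow> bool" where
  "euler_poincare_herglotz br l I \<xi> z \<longleftrightarrow>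
     (\<forall>t\<in>I.
        ((\<lambda>s. partial_vec l (\<xi> s) (z s)) has_vector_derivative
           ad_dual br (\<xi> t) (partial_vec l (\<xi> t) (z t))
           + partial_real l (\<xi> t) (z t) *\<^sub>R partial_vec l (\<xi> t) (z t)) (at t within I) \<and>
        (z has_real_derivative l (\<xi> t, z t)) (at t within I))"

text \<open>Differentiability of \<open>h\<close> along the curve is part of the meaning of the equations: it ensures
  that the partial derivatives occurring in them are not arbitrary values.\<close>

definition lie_poisson_herglotz ::
  "('g::real_normed_vector \<Rightarrow> 'g \<Rightarrow> 'g) \<Rightarrow> (('g \<Rightarrow>\<^sub>L real) \<times> real \<Rightarrow> real) \<Rightarrow>
   real set \<Rightarrow> (real \<Rightarrow> 'g \<Rightarrow>\<^sub>L real) \<Rightarrow> (real \<Rightarrow> real) \<Rightarrow> bool" where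
  "lie_poisson_herglotz br h I \<mu> z \<longleftrightarrow>
     (\<forall>t\<in>I.
        h differentiable (at (\<mu> t, z t)) \<and>
        (\<mu> has_vector_derivative
           ad_dual br (partial_dual h (\<mu> t) (z t)) (\<mu> t)
           - partial_real h (\<mu> t) (z t) *\<^sub>R \<mu> t) (at t within I) \<and>
        (z has_real_derivative
           blinfun_apply (\<mu> t) (partial_dual h (\<mu> t) (z t)) - h (\<mu> t, z t)) (at t within I))"

end

theory Submission
  imports Defs
begin

text \<open>Write \<open>\<Xi> (\<mu>, z)\<close> for the solution \<open>\<xi>\<close> of \<open>\<mu> = \<delta>l/\<delta>\<xi> (\<xi>, z)\<close>; it is differentiable because
  the inverse Legendre transformation is. In the derivative of \<open>h (\<mu>, z) = \<mu> (\<Xi> (\<mu>, z)) - l (\<Xi> (\<mu>, z), z)\<close>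
  the two terms containing \<open>D\<Xi>\<close> cancel, which leaves \<open>\<delta>h/\<delta>\<mu> = \<xi>\<close> and \<open>\<partial>h/\<partial>z = - \<partial>l/\<partial>z\<close>.
  Substituting these turns one system of equations into the other.

  Reading \<open>\<delta>h/\<delta>\<mu>\<close> in \<open>\<gg>\<close> needs the map \<open>\<gg> \<rightarrow> \<gg>\<^sup>*\<^sup>*\<close> to be injective. This follows from the
  Legendre transformation alone: a vector on which all functionals vanish is a direction in
  which \<open>l\<close>, hence also \<open>\<delta>l/\<delta>\<xi>\<close>, is constant.\<close>

lemma smooth_on_imp_differentiable:
  assumes "smooth_on S f" "x \<in> S"
  shows "f differentiable (at x)"
proof -
  have "Ck_on (Suc 0) S f"
    using assms(1) by (simp only: smooth_on_def)
  then show ?thesis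
    using assms(2) by simp
qed

text \<open>Chain rule along \<open>y \<mapsto> (y, z)\<close>. \<open>Blinfun\<close> is meaningful
  only on bounded linear maps, and the partial derivative is one because it is a Frechet
  derivative.\<close>

lemma partial_vec_apply:
  assumes "(f has_derivative f') (at (x, z))"
  shows "blinfun_apply (partial_vec f x z) v = f' (v, 0)"
proof -
  have "((\<lambda>y. f (y, z)) has_derivative (\<lambda>v. f' (v, 0))) (at x)"
    by (rule has_derivative_compose[where f = "\<lambda>y. (y, z)", OF _ assms])
      (auto intro!: derivative_eq_intros)
  then show ?thesis
    unfolding partial_vec_def
    by (metis bounded_linear_Blinfun_apply frechet_derivative_at has_derivative_bounded_linear)
qed

lemma partial_real_eq:
  assumes "(f has_derivative f') (at (x, z))"
  shows "partial_real f x z = f' (0, 1)"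
proof -
  interpret f': bounded_linear f'
    using assms by (rule has_derivative_bounded_linear)
  have "((\<lambda>s. f (x, s)) has_derivative (\<lambda>s. f' (0, s))) (at z)"
    by (rule has_derivative_compose[where f = "\<lambda>s. (x, s)", OF _ assms])
      (auto intro!: derivative_eq_intros)
  moreover have "f' (0, s) = f' (0, 1) * s" for s
    using f'.scaleR[of s "(0, 1)"] by simp
  then have "(\<lambda>s. f' (0, s)) = (*) (f' (0, 1))"
    by (rule ext)
  ultimately have "((\<lambda>s. f (x, s)) has_real_derivative f' (0, 1)) (at z)"
    by (simp add: has_field_derivative_def)
  then show ?thesis
    unfolding partial_real_def by (rule DERIV_imp_deriv)
qed

lemma bidual_map_apply: "blinfun_apply (bidual_map \<xi>) \<mu> = blinfun_apply \<mu> \<xi>"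
  unfolding bidual_map_def
  by (simp add: bounded_linear_Blinfun_apply blinfun.bounded_linear_left)

lemma blinfun_zero_imp_partial_vec_shift:
  fixes l :: "'g::real_normed_vector \<times> real \<Rightarrow> real"
  assumes diff: "\<And>p. l differentiable (at p)"
    and w: "\<And>\<nu> :: 'g \<Rightarrow>\<^sub>L real. blinfun_apply \<nu> w = 0"
  shows "partial_vec l (x + w) z = partial_vec l x z"
proof -
  have const: "l (y + w, z) = l (y, z)" for y
  proof -
    have "((\<lambda>s. l (y + s *\<^sub>R w, z)) has_derivative (\<lambda>_. 0)) (at s)" for s
    proof -
      obtain l' where l': "(l has_derivative l') (at (y + s *\<^sub>R w, z))"
        using diff by (auto simp: differentiable_def)
      interpret l': bounded_linear l'
        using l' by (rule has_derivative_bounded_linear)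
      \<comment> \<open>This number is the functional
        \<open>partial_vec l (y + s *\<^sub>R w) z\<close> evaluated at \<open>w\<close>, so it
        vanishes by the assumption on \<open>w\<close>.\<close>
      have "l' (w, 0) = 0"
        using partial_vec_apply[OF l', of w] w by simp
      then have "l' (r *\<^sub>R w, 0) = 0" for r
        using l'.scaleR[of r "(w, 0)"] by simp
      moreover have "((\<lambda>s. l (y + s *\<^sub>R w, z)) has_derivative (\<lambda>r. l' (r *\<^sub>R w, 0))) (at s)"
        by (rule has_derivative_compose[where f = "\<lambda>s. (y + s *\<^sub>R w, z)", OF _ l'])
          (auto intro!: derivative_eq_intros)
      ultimately show ?thesis
        by simp
    qed
    then obtain c where "\<And>s. l (y + s *\<^sub>R w, z) = c"
      using has_derivative_zero_constant[of UNIV "\<lambda>s. l (y + s *\<^sub>R w, z)"] by auto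
    from this[of 1] this[of 0] show ?thesis
      by simp
  qed
  obtain l' where l': "(l has_derivative l') (at (x, z))"
    using diff by (auto simp: differentiable_def)
  obtain m' where m': "(l has_derivative m') (at (x + w, z))"
    using diff by (auto simp: differentiable_def)
  have "((\<lambda>y. l (y, z)) has_derivative (\<lambda>v. l' (v, 0))) (at x)"
    by (rule has_derivative_compose[where f = "\<lambda>y. (y, z)", OF _ l'])
      (auto intro!: derivative_eq_intros)
  moreover have "((\<lambda>y. l (y + w, z)) has_derivative (\<lambda>v. m' (v, 0))) (at x)"
    by (rule has_derivative_compose[where f = "\<lambda>y. (y + w, z)", OF _ m'])
      (auto intro!: derivative_eq_intros)
  \<comment> \<open>By \<open>const\<close> both are derivatives at \<open>x\<close> of the same
    function \<open>\<lambda>y. l (y, z)\<close>.\<close>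
  ultimately have "(\<lambda>v. l' (v, 0)) = (\<lambda>v. m' (v, 0))"
    unfolding const by (rule has_derivative_unique)
  then show ?thesis
    by (intro blinfun_eqI) (simp add: partial_vec_apply[OF l'] partial_vec_apply[OF m'] fun_eq_iff)
qed

lemma inj_bidual_map:
  fixes l :: "'g::real_normed_vector \<times> real \<Rightarrow> real"
  assumes diff: "\<And>p. l differentiable (at p)" and inj: "inj (legendre l)"
  shows "inj (bidual_map :: 'g \<Rightarrow> _)"
proof (rule injI)
  fix x y :: 'g
  assume "bidual_map x = bidual_map y"
  then have "blinfun_apply \<nu> (x - y) = 0" for \<nu> :: "'g \<Rightarrow>\<^sub>L real"
    by (metis bidual_map_apply blinfun.diff_right diff_self)
  \<comment> \<open>The value 0 of the second variable is an arbitrary choice.\<close>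
  then have "partial_vec l (y + (x - y)) 0 = partial_vec l y 0"
    by (rule blinfun_zero_imp_partial_vec_shift[OF diff])
  then have "legendre l (x, 0) = legendre l (y, 0)"
    by (simp add: legendre_def)
  then show "x = y"
    using inj by (auto dest: injD)
qed

text \<open>Trades the definite description in the Hamiltonian for the inverse Legendre
  transformation, which can be differentiated. Bijectivity makes the described \<xi> exist and be
  unique.\<close>

lemma legendre_hamiltonian_eq:
  fixes l :: "'g::real_normed_vector \<times> real \<Rightarrow> real"
  assumes bij: "bij (legendre l)"
  defines "N \<equiv> inv_into UNIV (legendre l)"
  shows "legendre_hamiltonian l p = blinfun_apply (fst p) (fst (N p)) - l (N p)"
    and "snd (N p) = snd p"
proof -
  obtain \<mu> z where p: "p = (\<mu>, z)"
    by fastforce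
  obtain x s where N: "N p = (x, s)"
    by fastforce
  have "legendre l (N p) = p"
    unfolding N_def using bij by (simp add: bij_is_surj surj_f_inv_f)
  then have x: "\<mu> = partial_vec l x z" and s: "s = z"
    using N by (auto simp: p legendre_def)
  have "y = x" if "\<mu> = partial_vec l y z" for y
  proof -
    have "legendre l (y, z) = legendre l (x, z)"
      using that x by (simp add: legendre_def)
    then show ?thesis
      using bij by (auto simp: bij_def dest: injD)
  qed
  then have "(THE y. \<mu> = partial_vec l y z) = x"
    using x by blast
  then show "legendre_hamiltonian l p = blinfun_apply (fst p) (fst (N p)) - l (N p)"
    using N by (simp add: legendre_hamiltonian_def p s)
  show "snd (N p) = snd p"
    using N by (simp add: p s)
qed

lemma has_derivative_legendre_hamiltonian:
  fixes l :: "'g::real_normed_vector \<times> real \<Rightarrow> real"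
  assumes diff: "\<And>p. l differentiable (at p)"
    and diffeo: "diffeomorphism (legendre l)"
    and \<mu>: "\<mu> = partial_vec l x z"
  shows "(legendre_hamiltonian l has_derivative
            (\<lambda>v. blinfun_apply (fst v) x - snd v * partial_real l x z)) (at (\<mu>, z))"
proof -
  define N where "N = inv_into UNIV (legendre l)"
  have bij: "bij (legendre l)" and "smooth_on UNIV N"
    using diffeo by (auto simp: diffeomorphism_def N_def)
  then obtain N' where N': "(N has_derivative N') (at (\<mu>, z))"
    using smooth_on_imp_differentiable unfolding differentiable_def by blast
  have "legendre l (x, z) = (\<mu>, z)"
    by (simp add: legendre_def \<mu>)
  then have N: "N (\<mu>, z) = (x, z)"
    unfolding N_def using bij by (metis bij_is_inj inv_f_f)
  \<comment> \<open>\<open>N\<close> preserves the second coordinate, so differentiating that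
    identity determines the second component of \<open>N'\<close>.\<close>
  have "((\<lambda>p. snd (N p)) has_derivative (\<lambda>v. snd (N' v))) (at (\<mu>, z))"
    by (rule has_derivative_snd[OF N'])
  moreover have "(\<lambda>p. snd (N p)) = snd"
    using legendre_hamiltonian_eq(2)[OF bij] by (simp add: N_def fun_eq_iff)
  moreover have "(snd has_derivative snd) (at (\<mu>, z))"
    by (rule has_derivative_snd[OF has_derivative_ident])
  ultimately have "(\<lambda>v. snd (N' v)) = snd"
    by (metis has_derivative_unique)
  then have snd_N': "snd (N' v) = snd v" for v
    by (rule fun_cong)
  obtain l' where l': "(l has_derivative l') (at (x, z))"
    using diff by (auto simp: differentiable_def)
  interpret l': bounded_linear l'
    using l' by (rule has_derivative_bounded_linear)
  \<comment> \<open>The total derivative splits into partial ones, and the vector part is \<mu> by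
    the choice of \<open>x\<close>.\<close>
  have l'_eq: "l' (a, b) = blinfun_apply \<mu> a + b * partial_real l x z" for a b
    using l'.add[of "(a, 0)" "(0, b)"] l'.scaleR[of b "(0, 1)"]
    by (simp add: \<mu> partial_vec_apply[OF l'] partial_real_eq[OF l'])
  have "((\<lambda>p. l (N p)) has_derivative (\<lambda>v. l' (N' v))) (at (\<mu>, z))"
    using has_derivative_compose[OF N', of l l'] l' by (simp add: N)
  moreover have "((\<lambda>p. blinfun_apply (fst p) (fst (N p))) has_derivative
      (\<lambda>v. blinfun_apply \<mu> (fst (N' v)) + blinfun_apply (fst v) x)) (at (\<mu>, z))"
    using blinfun.FDERIV[OF has_derivative_fst[OF has_derivative_ident] has_derivative_fst[OF N']]
    by (simp add: N)
  ultimately have "((\<lambda>p. blinfun_apply (fst p) (fst (N p)) - l (N p)) has_derivative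
      (\<lambda>v. blinfun_apply \<mu> (fst (N' v)) + blinfun_apply (fst v) x - l' (N' v))) (at (\<mu>, z))"
    by (rule has_derivative_diff[rotated])
  \<comment> \<open>The first summand cancels the one that the product rule gives for the
    pairing.\<close>
  moreover have "l' (N' v) = blinfun_apply \<mu> (fst (N' v)) + snd v * partial_real l x z" for v
    using l'_eq[of "fst (N' v)" "snd (N' v)"] unfolding prod.collapse by (simp add: snd_N')
  moreover have "legendre_hamiltonian l = (\<lambda>p. blinfun_apply (fst p) (fst (N p)) - l (N p))"
    using legendre_hamiltonian_eq(1)[OF bij] by (simp add: N_def fun_eq_iff)
  ultimately show ?thesis
    by simp
qed

theorem proposition5p2:
  fixes G :: "('a, 'b) monoid_scheme"
    and X :: "'a topology"
    and A :: "('a, 'e::real_normed_vector) chart set"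
    and br :: "'g::real_normed_vector \<Rightarrow> 'g \<Rightarrow> 'g"
    and l :: "'g \<times> real \<Rightarrow> real"
    and h :: "('g \<Rightarrow>\<^sub>L real) \<times> real \<Rightarrow> real"
    and I :: "real set"
    and \<xi> :: "real \<Rightarrow> 'g"
    and \<mu> :: "real \<Rightarrow> 'g \<Rightarrow>\<^sub>L real"
    and z :: "real \<Rightarrow> real"
  assumes "lie_group G X A"
    and "lie_algebra_of G A br"
    and "smooth_on UNIV l"
    and "regular_lagrangian l"
    and "diffeomorphism (legendre l)"
    and "h = legendre_hamiltonian l"
    and "is_interval I"
    and "euler_poincare_herglotz br l I \<xi> z"
    and "\<And>t. t \<in> I \<Longrightarrow> \<mu> t = partial_vec l (\<xi> t) (z t)"
  shows "lie_poisson_herglotz br h I \<mu> z"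
  unfolding lie_poisson_herglotz_def
proof
  fix t
  assume t: "t \<in> I"
  have diff: "l differentiable (at p)" for p
    using assms(3) by (simp add: smooth_on_imp_differentiable)
  have bij: "bij (legendre l)"
    using assms(5) by (simp add: diffeomorphism_def)
  let ?x = "\<xi> t" and ?z = "z t"
  have \<mu>: "\<mu> t = partial_vec l ?x ?z"
    using assms(9) t .
  have h': "(h has_derivative (\<lambda>v. blinfun_apply (fst v) ?x - snd v * partial_real l ?x ?z))
      (at (\<mu> t, ?z))"
    unfolding assms(6) by (rule has_derivative_legendre_hamiltonian[OF diff assms(5) \<mu>])
  \<comment> \<open>The derivative in \<mu> is evaluation at \<open>?x\<close>; injectivity of
    \<open>bidual_map\<close> then lets \<open>inv_into\<close> recover \<open>?x\<close>
    itself.\<close>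
  have "partial_vec h (\<mu> t) ?z = bidual_map ?x"
    by (rule blinfun_eqI) (simp add: partial_vec_apply[OF h'] bidual_map_apply)
  then have dual: "partial_dual h (\<mu> t) ?z = ?x"
    using inj_bidual_map[OF diff bij_is_inj[OF bij]] by (simp add: partial_dual_def)
  have real: "partial_real h (\<mu> t) ?z = - partial_real l ?x ?z"
    by (simp add: partial_real_eq[OF h'])
  \<comment> \<open>The resulting value of \<open>h\<close> turns the right-hand side of the new
    equation for \<open>z\<close> back into \<open>l (?x, ?z)\<close>.\<close>
  have "inv_into UNIV (legendre l) (\<mu> t, ?z) = (?x, ?z)"
    using inv_f_f[OF bij_is_inj[OF bij], of "(?x, ?z)"] by (simp add: legendre_def \<mu>)
  then have "h (\<mu> t, ?z) = blinfun_apply (\<mu> t) ?x - l (?x, ?z)"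
    by (simp add: assms(6) legendre_hamiltonian_eq(1)[OF bij])
  moreover have "((\<lambda>s. partial_vec l (\<xi> s) (z s)) has_vector_derivative
      ad_dual br ?x (\<mu> t) + partial_real l ?x ?z *\<^sub>R \<mu> t) (at t within I)"
    and "(z has_real_derivative l (?x, ?z)) (at t within I)"
    using assms(8) t by (auto simp: euler_poincare_herglotz_def \<mu>)
  \<comment> \<open>The curve \<mu> is prescribed only on \<open>I\<close>, which suffices for a
    derivative within \<open>I\<close>.\<close>
  moreover from this(1) have "(\<mu> has_vector_derivative
      ad_dual br ?x (\<mu> t) + partial_real l ?x ?z *\<^sub>R \<mu> t) (at t within I)"
    by (rule has_vector_derivative_transform[OF t, rotated]) (simp add: assms(9))
  ultimately show "h differentiable (at (\<mu> t, z t)) \<and>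
      (\<mu> has_vector_derivative ad_dual br (partial_dual h (\<mu> t) (z t)) (\<mu> t)
         - partial_real h (\<mu> t) (z t) *\<^sub>R \<mu> t) (at t within I) \<and>
      (z has_real_derivative
         blinfun_apply (\<mu> t) (partial_dual h (\<mu> t) (z t)) - h (\<mu> t, z t)) (at t within I)"
    using h' by (auto simp: dual real differentiable_def)
qed

end
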